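(* Let $M$ be a Coxeter matrix with Coxeter group $W$ and let $\Phi:K\to\mathbb{Z}[x,x^{-1}]$ be any map. The assignment $$\Delta_\Phi(\sigma_s)=\sigma_s,\qquad \Delta_\Phi(\tau_s)=\Phi(K_s)[\sigma_s],\qquad s\in S,$$ extends uniquely to a monoid homomorphism $\Delta_\Phi:\mathbf{SB}(W)\to\mathbb{Z}(\mathbf{B}(W))$.
   Context: A Coxeter matrix $M=(m_{s,t})_{s,t\in S}$, indexed by a finite nonempty set $S$, is a symmetric matrix with entries in $\mathbb{Z}_{>0}\cup\{\infty\}$ with $m_{s,s}=1$ and $m_{s,t}\ne 1$ for $s\neq t$. The Coxeter group $W=W(M)$ is generated by $S$ subject to $(st)^{m_{s,t}}=e$ whenever $m_{s,t}\neq\infty$. Its Coxeter graph $\Gamma_M$ has vertex set $S$ and an edge between $s\ne t$ iff $m_{s,t}>2$, marked by $m_{s,t}$ when $m_{s,t}>3$. The odd skeleton $\mathbf{O}(\Gamma_M)$ is obtained from $\Gamma_M$ by removing all edges marked by even numbers or by $\infty$. $K$ denotes the set of connected components of $\mathbf{O}(\Gamma_M)$, and $K_s\in K$ is the component containing $s\in S$. The Artin group $\mathbf{B}(W)$ is the group generated by $\sigma_s$, $s\in S$, subject to (R1) $\sigma_s\sigma_t\sigma_s\cdots=\sigma_t\sigma_s\sigma_t\cdots$ ($m_{s,t}$ factors on each side) for $s\neq t$ with $m_{s,t}\ne\infty$. The singular Artin monoid $\mathbf{SB}(W)$ is the monoid generated by invertible elements $\sigma_s$ and elements $\tau_s$,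 $s\in S$, subject to (R1) and: (R2) $\tau_s\sigma_t\sigma_s\cdots\sigma_t\sigma_s=\sigma_t\sigma_s\sigma_t\cdots\sigma_s\tau_t$ ($m_{s,t}$ factors on each side) for $s\ne t$ with $m_{s,t}\neq\infty$ odd; (R3) $\tau_s\sigma_t\sigma_s\cdots\sigma_s\sigma_t=\sigma_t\sigma_s\sigma_t\cdots\sigma_t\tau_s$ ($m_{s,t}$ factors on each side) for $s\ne t$ with $m_{s,t}\ne\infty$ even; (R4) $\tau_s\tau_t=\tau_t\tau_s$ if $m_{s,t}=2$; (R5) $\tau_s\sigma_s=\sigma_s\tau_s$. $\mathbb{Z}(\mathbf{B}(W))$ is the integral group algebra of $\mathbf{B}(W)$, considered as a monoid under multiplication; $\Phi(K_s)[\sigma_s]$ is the result of substituting $x=\sigma_s$ in the Laurent polynomial $\Phi(K_s)$. *)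

theory Defs
  imports "HOL-Algebra.Ring" "HOL-Library.Poly_Mapping" "HOL-Library.Extended_Nat"
begin

inductive_set word_cong :: "'a set \<Rightarrow> ('a list \<times> 'a list) set \<Rightarrow> ('a list \<times> 'a list) set"
  for A :: "'a set" and R :: "('a list \<times> 'a list) set"
  where
    rel: "\<lbrakk>(u, v) \<in> R; u \<in> lists A; v \<in> lists A; p \<in> lists A; q \<in> lists A\<rbrakk>
            \<Longrightarrow> (p @ u @ q, p @ v @ q) \<in> word_cong A R"
  | refl: "u \<in> lists A \<Longrightarrow> (u, u) \<in> word_cong A R"
  | sym: "(u, v) \<in> word_cong A R \<Longrightarrow> (v, u) \<in> word_cong A R"
  | trans: "\<lbrakk>(u, v) \<in> word_cong A R; (v, w) \<in> word_cong A R\<rbrakk> \<Longrightarrow> (u, w) \<in> word_cong A R"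

definition presented_monoid :: "'a set \<Rightarrow> ('a list \<times> 'a list) set \<Rightarrow> 'a list set monoid"
  where "presented_monoid A R =
    \<lparr>carrier = lists A // word_cong A R,
     mult = (\<lambda>X Y. \<Union>x\<in>X. \<Union>y\<in>Y. word_cong A R `` {x @ y}),
     one = word_cong A R `` {[]}\<rparr>"

lemma word_cong_in_lists:
  assumes "(u, v) \<in> word_cong A R"
  shows "u \<in> lists A" "v \<in> lists A"
  using assms by (induction rule: word_cong.induct) auto

lemma equiv_word_cong: "equiv (lists A) (word_cong A R)"
proof (rule equivI)
  show "word_cong A R \<subseteq> lists A \<times> lists A"
    using word_cong_in_lists by fast
  show "refl_on (lists A) (word_cong A R)"
    by (rule refl_onI) (rule word_cong.refl)
  show "sym (word_cong A R)"
    by (rule symI) (rule word_cong.sym)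
  show "trans (word_cong A R)"
    by (rule transI) (rule word_cong.trans)
qed

lemma word_cong_context:
  assumes "(u, v) \<in> word_cong A R" "p \<in> lists A" "q \<in> lists A"
  shows "(p @ u @ q, p @ v @ q) \<in> word_cong A R"
  using assms
proof (induction rule: word_cong.induct)
  case (rel u v p' q')
  have "((p @ p') @ u @ (q' @ q), (p @ p') @ v @ (q' @ q)) \<in> word_cong A R"
    using rel by (intro word_cong.rel) auto
  then show ?case by simp
next
  case (refl u)
  then show ?case by (intro word_cong.refl) auto
next
  case (sym u v)
  then show ?case by (blast intro: word_cong.sym)
next
  case (trans u v w)
  then show ?case by (blast intro: word_cong.trans)
qed

lemma word_cong_append:
  assumes "(u, u') \<in> word_cong A R" "(v, v') \<in> word_cong A R"
  shows "(u @ v, u' @ v') \<in> word_cong A R"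
proof (rule word_cong.trans)
  show "(u @ v, u' @ v) \<in> word_cong A R"
    using word_cong_context[OF assms(1), of "[]" v] word_cong_in_lists[OF assms(2)] by simp
  show "(u' @ v, u' @ v') \<in> word_cong A R"
    using word_cong_context[OF assms(2), of u' "[]"] word_cong_in_lists[OF assms(1)] by simp
qed

lemma presented_monoid_mult:
  assumes "u \<in> lists A" "v \<in> lists A"
  shows "word_cong A R `` {u} \<otimes>\<^bsub>presented_monoid A R\<^esub> word_cong A R `` {v} =
         word_cong A R `` {u @ v}"
proof -
  have "word_cong A R `` {x @ y} = word_cong A R `` {u @ v}"
    if "(u, x) \<in> word_cong A R" "(v, y) \<in> word_cong A R" for x y
    using equiv_class_eq[OF equiv_word_cong word_cong_append[OF that]] by simp
  then show ?thesis
    using assms by (auto simp: presented_monoid_def intro: word_cong.refl)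
qed

lemma carrier_presented_monoidE:
  assumes "X \<in> carrier (presented_monoid A R)"
  obtains u where "u \<in> lists A" "X = word_cong A R `` {u}"
  using assms that by (auto simp: presented_monoid_def quotient_def simp del: in_lists_conv_set)

lemma class_in_presented_monoid:
  "u \<in> lists A \<Longrightarrow> word_cong A R `` {u} \<in> carrier (presented_monoid A R)"
  by (simp add: presented_monoid_def quotientI)

lemma one_presented_monoid: "\<one>\<^bsub>presented_monoid A R\<^esub> = word_cong A R `` {[]}"
  by (simp add: presented_monoid_def)

lemma monoid_presented_monoid: "monoid (presented_monoid A R)"
proof (rule monoidI)
  fix X Y assume "X \<in> carrier (presented_monoid A R)" "Y \<in> carrier (presented_monoid A R)"
  then show "X \<otimes>\<^bsub>presented_monoid A R\<^esub> Y \<in> carrier (presented_monoid A R)"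
    by (metis append_in_lists_conv carrier_presented_monoidE class_in_presented_monoid
        presented_monoid_mult)
next
  fix X Y Z
  assume "X \<in> carrier (presented_monoid A R)" "Y \<in> carrier (presented_monoid A R)"
    "Z \<in> carrier (presented_monoid A R)"
  then show "X \<otimes>\<^bsub>presented_monoid A R\<^esub> Y \<otimes>\<^bsub>presented_monoid A R\<^esub> Z =
      X \<otimes>\<^bsub>presented_monoid A R\<^esub> (Y \<otimes>\<^bsub>presented_monoid A R\<^esub> Z)"
    by (elim carrier_presented_monoidE)
      (simp only: presented_monoid_mult append_in_lists_conv simp_thms append_assoc)
next
  show "\<one>\<^bsub>presented_monoid A R\<^esub> \<in> carrier (presented_monoid A R)"
    by (simp add: one_presented_monoid class_in_presented_monoid)
next
  fix X assume X: "X \<in> carrier (presented_monoid A R)"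
  show "\<one>\<^bsub>presented_monoid A R\<^esub> \<otimes>\<^bsub>presented_monoid A R\<^esub> X = X"
    by (rule carrier_presented_monoidE[OF X]) (simp add: presented_monoid_mult one_presented_monoid)
  show "X \<otimes>\<^bsub>presented_monoid A R\<^esub> \<one>\<^bsub>presented_monoid A R\<^esub> = X"
    by (rule carrier_presented_monoidE[OF X]) (simp add: presented_monoid_mult one_presented_monoid)
qed

locale coxeter_matrix =
  fixes S :: "'s set" and m :: "'s \<Rightarrow> 's \<Rightarrow> enat"
  assumes finite_index: "finite S"
    and index_nonempty: "S \<noteq> {}"
    and symmetric: "\<lbrakk>s \<in> S; t \<in> S\<rbrakk> \<Longrightarrow> m s t = m t s"
    and nonzero: "\<lbrakk>s \<in> S; t \<in> S\<rbrakk> \<Longrightarrow> m s t \<noteq> 0"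
    and diagonal: "s \<in> S \<Longrightarrow> m s s = 1"
    and off_diagonal: "\<lbrakk>s \<in> S; t \<in> S; s \<noteq> t\<rbrakk> \<Longrightarrow> m s t \<noteq> 1"

definition coxeter_graph :: "'s set \<Rightarrow> ('s \<Rightarrow> 's \<Rightarrow> enat) \<Rightarrow> ('s \<times> 's) set"
  where "coxeter_graph S m = {(s, t). s \<in> S \<and> t \<in> S \<and> s \<noteq> t \<and> m s t > 2}"

definition odd_skeleton :: "'s set \<Rightarrow> ('s \<Rightarrow> 's \<Rightarrow> enat) \<Rightarrow> ('s \<times> 's) set"
  where "odd_skeleton S m =
    coxeter_graph S m - {(s, t). m s t = \<infinity> \<or> (\<exists>n. m s t = enat n \<and> even n)}"

definition odd_component :: "'s set \<Rightarrow> ('s \<Rightarrow> 's \<Rightarrow> enat) \<Rightarrow> 's \<Rightarrow> 's set"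
  where "odd_component S m s = (odd_skeleton S m)\<^sup>* `` {s}"

definition odd_components :: "'s set \<Rightarrow> ('s \<Rightarrow> 's \<Rightarrow> enat) \<Rightarrow> 's set set"
  where "odd_components S m = odd_component S m ` S"

datatype 's letter = Sig 's | SigInv 's | Tau 's

primrec alternating :: "'a \<Rightarrow> 'a \<Rightarrow> nat \<Rightarrow> 'a list"
  where
    "alternating a b 0 = []"
  | "alternating a b (Suc n) = a # alternating b a n"

definition inverse_rels :: "'s set \<Rightarrow> ('s letter list \<times> 's letter list) set"
  where "inverse_rels S =
    (\<Union>s\<in>S. {([Sig s, SigInv s], []), ([SigInv s, Sig s], [])})"

definition braid_rels :: "'s set \<Rightarrow> ('s \<Rightarrow> 's \<Rightarrow> enat) \<Rightarrow> ('s letter list \<times> 's letter list) set"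
  where "braid_rels S m =
    {(alternating (Sig s) (Sig t) n, alternating (Sig t) (Sig s) n) | s t n.
       s \<in> S \<and> t \<in> S \<and> s \<noteq> t \<and> m s t = enat n}"

text \<open>In the first two sets below each side has length \<open>n = m s t\<close>, the letter \<open>Tau\<close> included;
  the word \<open>alternating (Sig t) (Sig s) (n - 1)\<close> ends in \<open>Sig s\<close> if \<open>n\<close> is odd and in \<open>Sig t\<close>
  if \<open>n\<close> is even.\<close>

definition singular_rels :: "'s set \<Rightarrow> ('s \<Rightarrow> 's \<Rightarrow> enat) \<Rightarrow> ('s letter list \<times> 's letter list) set"
  where "singular_rels S m =
    {(Tau s # alternating (Sig t) (Sig s) (n - 1), alternating (Sig t) (Sig s) (n - 1) @ [Tau t])
       | s t n. s \<in> S \<and> t \<in> S \<and> s \<noteq> t \<and> m s t = enat n \<and> odd n} \<union>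
    {(Tau s # alternating (Sig t) (Sig s) (n - 1), alternating (Sig t) (Sig s) (n - 1) @ [Tau s])
       | s t n. s \<in> S \<and> t \<in> S \<and> s \<noteq> t \<and> m s t = enat n \<and> even n} \<union>
    {([Tau s, Tau t], [Tau t, Tau s]) | s t. s \<in> S \<and> t \<in> S \<and> m s t = 2} \<union>
    {([Tau s, Sig s], [Sig s, Tau s]) | s. s \<in> S}"

definition artin_letters :: "'s set \<Rightarrow> 's letter set"
  where "artin_letters S = Sig ` S \<union> SigInv ` S"

definition singular_letters :: "'s set \<Rightarrow> 's letter set"
  where "singular_letters S = artin_letters S \<union> Tau ` S"

definition artin_rels :: "'s set \<Rightarrow> ('s \<Rightarrow> 's \<Rightarrow> enat) \<Rightarrow> ('s letter list \<times> 's letter list) set"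
  where "artin_rels S m = inverse_rels S \<union> braid_rels S m"

definition singular_artin_rels ::
    "'s set \<Rightarrow> ('s \<Rightarrow> 's \<Rightarrow> enat) \<Rightarrow> ('s letter list \<times> 's letter list) set"
  where "singular_artin_rels S m = inverse_rels S \<union> braid_rels S m \<union> singular_rels S m"

text \<open>The group presentation of the Artin group is expressed as a monoid presentation with formal
  inverses of the generators; that the result is a group is the lemma \<open>group_artin_group\<close>.\<close>

definition artin_group :: "'s set \<Rightarrow> ('s \<Rightarrow> 's \<Rightarrow> enat) \<Rightarrow> 's letter list set monoid"
  where "artin_group S m = presented_monoid (artin_letters S) (artin_rels S m)"

definition singular_artin_monoid :: "'s set \<Rightarrow> ('s \<Rightarrow> 's \<Rightarrow> enat) \<Rightarrow> 's letter list set monoid"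
  where "singular_artin_monoid S m =
    presented_monoid (singular_letters S) (singular_artin_rels S m)"

definition artin_sigma :: "'s set \<Rightarrow> ('s \<Rightarrow> 's \<Rightarrow> enat) \<Rightarrow> 's \<Rightarrow> 's letter list set"
  where "artin_sigma S m s = word_cong (artin_letters S) (artin_rels S m) `` {[Sig s]}"

definition singular_sigma :: "'s set \<Rightarrow> ('s \<Rightarrow> 's \<Rightarrow> enat) \<Rightarrow> 's \<Rightarrow> 's letter list set"
  where "singular_sigma S m s =
    word_cong (singular_letters S) (singular_artin_rels S m) `` {[Sig s]}"

definition singular_tau :: "'s set \<Rightarrow> ('s \<Rightarrow> 's \<Rightarrow> enat) \<Rightarrow> 's \<Rightarrow> 's letter list set"
  where "singular_tau S m s =
    word_cong (singular_letters S) (singular_artin_rels S m) `` {[Tau s]}"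

lemma artin_letter_class_Units:
  assumes "a \<in> artin_letters S"
  shows "word_cong (artin_letters S) (artin_rels S m) `` {[a]} \<in> Units (artin_group S m)"
proof -
  let ?A = "artin_letters S" and ?R = "artin_rels S m"
  let ?cl = "\<lambda>w. word_cong ?A ?R `` {w}"
  obtain s where s: "s \<in> S" "a = Sig s \<or> a = SigInv s"
    using assms by (auto simp: artin_letters_def)
  define b where "b = (case a of Sig s \<Rightarrow> SigInv s | SigInv s \<Rightarrow> Sig s | Tau s \<Rightarrow> Tau s)"
  have b: "b \<in> ?A" "([a, b], []) \<in> ?R" "([b, a], []) \<in> ?R"
    using s by (auto simp: b_def artin_letters_def artin_rels_def inverse_rels_def)
  have "([a, b], []) \<in> word_cong ?A ?R" "([b, a], []) \<in> word_cong ?A ?R"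
    using b assms word_cong.rel[of "[a, b]" "[]" ?R ?A "[]" "[]"]
      word_cong.rel[of "[b, a]" "[]" ?R ?A "[]" "[]"] by auto
  then have "?cl [a, b] = ?cl []" "?cl [b, a] = ?cl []"
    using equiv_class_eq[OF equiv_word_cong] by metis+
  then have "?cl [a] \<otimes>\<^bsub>artin_group S m\<^esub> ?cl [b] = \<one>\<^bsub>artin_group S m\<^esub>"
    "?cl [b] \<otimes>\<^bsub>artin_group S m\<^esub> ?cl [a] = \<one>\<^bsub>artin_group S m\<^esub>"
    using assms b by (auto simp: artin_group_def presented_monoid_mult one_presented_monoid)
  moreover have "?cl [a] \<in> carrier (artin_group S m)" "?cl [b] \<in> carrier (artin_group S m)"
    using assms b by (auto simp: artin_group_def intro!: class_in_presented_monoid)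
  ultimately show ?thesis
    by (auto simp: Units_def)
qed

lemma group_artin_group: "group (artin_group S m)"
proof -
  let ?G = "artin_group S m" and ?A = "artin_letters S" and ?R = "artin_rels S m"
  interpret monoid ?G
    unfolding artin_group_def by (rule monoid_presented_monoid)
  have unit: "word_cong ?A ?R `` {w} \<in> Units ?G" if "w \<in> lists ?A" for w
    using that
  proof (induction w)
    case Nil
    then show ?case
      using Units_one_closed by (simp add: artin_group_def one_presented_monoid)
  next
    case (Cons a w)
    have "word_cong ?A ?R `` {[a]} \<otimes>\<^bsub>?G\<^esub> word_cong ?A ?R `` {w} = word_cong ?A ?R `` {a # w}"
      using Cons presented_monoid_mult[of "[a]" ?A w ?R] by (simp add: artin_group_def)
    then show ?case
      using Units_m_closed[OF artin_letter_class_Units[of a S m] Cons.IH] Cons.hyps by simp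
  qed
  show ?thesis
  proof unfold_locales
    show "carrier ?G \<subseteq> Units ?G"
      using unit by (auto simp: artin_group_def elim!: carrier_presented_monoidE)
  qed
qed

text \<open>Finitely supported integer combinations \<open>\<Sum>g. c\<^sub>g g\<close> of group elements; the product is the
  bilinear extension of the product of the group, and \<open>frag_of\<close> is the inclusion of the group.\<close>

definition group_ring :: "('g, 'r) monoid_scheme \<Rightarrow> ('g \<Rightarrow>\<^sub>0 int) ring"
  where "group_ring G =
    \<lparr>carrier = {c. Poly_Mapping.keys c \<subseteq> carrier G},
     mult = (\<lambda>x y. frag_extend (\<lambda>g. frag_extend (\<lambda>h. frag_of (g \<otimes>\<^bsub>G\<^esub> h)) y) x),
     one = frag_of \<one>\<^bsub>G\<^esub>,
     zero = 0,
     add = (+)\<rparr>"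

lemma frag_extend_lincomb:
  fixes f g :: "'b \<Rightarrow> 'a \<Rightarrow>\<^sub>0 int"
  shows "frag_extend (\<lambda>i. f i + g i) x = frag_extend f x + frag_extend g x"
  by (simp add: frag_extend_def frag_cmul_distrib2 sum.distrib)

lemma ring_group_ring:
  assumes "group G"
  shows "ring (group_ring G)"
proof -
  interpret group G by fact
  let ?M = "\<lambda>x y. frag_extend (\<lambda>g. frag_extend (\<lambda>h. frag_of (g \<otimes>\<^bsub>G\<^esub> h)) y) x"
  have closed: "Poly_Mapping.keys (?M x y) \<subseteq> carrier G"
    if "Poly_Mapping.keys x \<subseteq> carrier G" "Poly_Mapping.keys y \<subseteq> carrier G" for x y
  proof -
    have "Poly_Mapping.keys (frag_extend (\<lambda>h. frag_of (g \<otimes>\<^bsub>G\<^esub> h)) y) \<subseteq> carrier G"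
      if "g \<in> carrier G" for g
      using keys_frag_extend[of "\<lambda>h. frag_of (g \<otimes>\<^bsub>G\<^esub> h)" y] that
        \<open>Poly_Mapping.keys y \<subseteq> carrier G\<close> by fastforce
    then show ?thesis
      using keys_frag_extend[of "\<lambda>g. frag_extend (\<lambda>h. frag_of (g \<otimes>\<^bsub>G\<^esub> h)) y" x] that
      by blast
  qed
  have assoc: "?M (?M x y) z = ?M x (?M y z)"
    if "Poly_Mapping.keys x \<subseteq> carrier G" "Poly_Mapping.keys y \<subseteq> carrier G"
      "Poly_Mapping.keys z \<subseteq> carrier G" for x y z
    using that(1)
  proof (induction x rule: frag_induction)
    case (one g)
    show ?case
      using that(2)
    proof (induction y rule: frag_induction)
      case (one h)
      show ?case
        using that(3)
      proof (induction z rule: frag_induction)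
        case (one k)
        then show ?case
          using \<open>g \<in> carrier G\<close> \<open>h \<in> carrier G\<close> by (simp add: m_assoc)
      qed (simp_all add: frag_extend_diff)
    qed (simp_all add: frag_extend_diff)
  qed (simp_all add: frag_extend_diff)
  have one_left: "?M (frag_of \<one>\<^bsub>G\<^esub>) x = x" if "Poly_Mapping.keys x \<subseteq> carrier G" for x
    using that by (induction x rule: frag_induction) (simp_all add: frag_extend_diff)
  have one_right: "?M x (frag_of \<one>\<^bsub>G\<^esub>) = x" if "Poly_Mapping.keys x \<subseteq> carrier G" for x
    using that by (induction x rule: frag_induction) (simp_all add: frag_extend_diff)
  have grp: "abelian_group (group_ring G)"
  proof (rule abelian_groupI)
    fix x y assume "x \<in> carrier (group_ring G)" "y \<in> carrier (group_ring G)"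
    then show "x \<oplus>\<^bsub>group_ring G\<^esub> y \<in> carrier (group_ring G)"
      using keys_add[of x y] by (auto simp: group_ring_def)
  next
    fix x assume "x \<in> carrier (group_ring G)"
    then show "\<exists>y\<in>carrier (group_ring G). y \<oplus>\<^bsub>group_ring G\<^esub> x = \<zero>\<^bsub>group_ring G\<^esub>"
      by (intro bexI[of _ "- x"]) (simp_all add: group_ring_def)
  qed (simp_all add: group_ring_def add.assoc add.commute)
  have mon: "Group.monoid (group_ring G)"
    by (rule monoidI) (use closed assoc one_left one_right in \<open>simp_all add: group_ring_def\<close>)
  show ?thesis
    by (rule ringI[OF grp mon])
      (simp_all add: group_ring_def frag_extend_add frag_extend_lincomb)
qed

text \<open>\<open>p :: int \<Rightarrow>\<^sub>0 int\<close> stands for the integral Laurent polynomial \<open>\<Sum>k. p\<^sub>k x\<^sup>k\<close>.\<close>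

type_synonym laurent_poly = "int \<Rightarrow>\<^sub>0 int"

definition laurent_subst :: "('g, 'r) monoid_scheme \<Rightarrow> laurent_poly \<Rightarrow> 'g \<Rightarrow> ('g \<Rightarrow>\<^sub>0 int)"
  where "laurent_subst G p g = frag_extend (\<lambda>k. frag_of (g [^]\<^bsub>G\<^esub> k)) p"

end

theory Submission
  imports Defs
begin

text \<open>
  A homomorphism out of a presented monoid is the same thing as an assignment of values to the
  letters under which both sides of every defining relation get the same value.  So existence of
  \<open>\<Delta>\<^sub>\<Phi>\<close> is a check of relations in the group ring \<open>\<int>[B]\<close> of the Artin group \<open>B\<close>.

  On words without \<open>\<tau>\<close> the assignment is the inclusion of \<open>B\<close> in \<open>\<int>[B]\<close>, so the invertibility
  relations and the braid relations hold because they hold in \<open>B\<close>.  The relations with \<open>\<tau>\<close> all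
  come from one principle, \<open>laurent_subst_frag_of_swap\<close>: if \<open>g w = w h\<close> in a group, then
  \<open>g\<^sup>k w = w h\<^sup>k\<close> for every integer \<open>k\<close>, hence \<open>p[g] w = w p[h]\<close> for every Laurent polynomial \<open>p\<close>.
  Indeed, write \<open>w = \<sigma>\<^sub>t \<sigma>\<^sub>s \<sigma>\<^sub>t \<cdots>\<close> with \<open>m\<^sub>s\<^sub>t - 1\<close> factors.  The braid relation says
  \<open>\<sigma>\<^sub>s w = w \<sigma>\<^sub>t\<close> if \<open>m\<^sub>s\<^sub>t\<close> is odd and \<open>\<sigma>\<^sub>s w = w \<sigma>\<^sub>s\<close> if \<open>m\<^sub>s\<^sub>t\<close> is even, and the two kinds of mixed
  relations are these equations with the outer \<open>\<sigma>\<close> replaced by the matching \<open>\<tau>\<close>.  In the even case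
  the same polynomial stands on both sides; in the odd case \<open>s\<close> and \<open>t\<close> are adjacent in the odd
  skeleton, so \<open>\<Phi>(K\<^sub>s) = \<Phi>(K\<^sub>t)\<close>; this is why \<open>\<Phi>\<close> is a function of the component.  The relation
  \<open>\<tau>\<^sub>s \<sigma>\<^sub>s = \<sigma>\<^sub>s \<tau>\<^sub>s\<close> is the case \<open>g = w = h = \<sigma>\<^sub>s\<close>, and \<open>\<tau>\<^sub>s \<tau>\<^sub>t = \<tau>\<^sub>t \<tau>\<^sub>s\<close> for \<open>m\<^sub>s\<^sub>t = 2\<close> follows from the
  principle applied once in each of the two commuting variables \<open>\<sigma>\<^sub>s\<close> and \<open>\<sigma>\<^sub>t\<close>
  (\<open>laurent_subst_commute\<close>).

  For uniqueness, a homomorphism is determined by its values on the letters; the values on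
  \<open>\<sigma>\<^sub>s\<close> and \<open>\<tau>\<^sub>s\<close> are prescribed, and the value on \<open>\<sigma>\<^sub>s\<inverse>\<close> is forced because inverses in a monoid are
  unique.
\<close>

section \<open>Homomorphisms out of a presented monoid\<close>

definition eval_word :: "('b, 'r) monoid_scheme \<Rightarrow> ('a \<Rightarrow> 'b) \<Rightarrow> 'a list \<Rightarrow> 'b"
  where "eval_word N f w = foldr (\<lambda>a x. f a \<otimes>\<^bsub>N\<^esub> x) w \<one>\<^bsub>N\<^esub>"

lemma eval_word_simps [simp]:
  "eval_word N f [] = \<one>\<^bsub>N\<^esub>"
  "eval_word N f (a # w) = f a \<otimes>\<^bsub>N\<^esub> eval_word N f w"
  by (simp_all add: eval_word_def)

context monoid
begin

lemma eval_word_closed: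
  assumes "f \<in> A \<rightarrow> carrier G" "w \<in> lists A"
  shows "eval_word G f w \<in> carrier G"
  using assms(2) by (induction w) (use assms(1) in auto)

lemma eval_word_append:
  assumes "f \<in> A \<rightarrow> carrier G" "u \<in> lists A" "v \<in> lists A"
  shows "eval_word G f (u @ v) = eval_word G f u \<otimes> eval_word G f v"
  using assms(2)
proof (induction u)
  case Nil
  then show ?case using eval_word_closed[OF assms(1,3)] by simp
next
  case (Cons a u)
  then show ?case
    using eval_word_closed[OF assms(1,3)] eval_word_closed[OF assms(1)] assms(1)
    by (auto simp: m_assoc Pi_iff)
qed

lemma eval_word_cong:
  assumes f: "f \<in> A \<rightarrow> carrier G"
    and rels: "\<And>u v. \<lbrakk>(u, v) \<in> R; u \<in> lists A; v \<in> lists A\<rbrakk> \<Longrightarrow> eval_word G f u = eval_word G f v"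
    and "(u, v) \<in> word_cong A R"
  shows "eval_word G f u = eval_word G f v"
  using assms(3)
proof (induction rule: word_cong.induct)
  case (rel u v p q)
  have "u @ q \<in> lists A" "v @ q \<in> lists A"
    using rel by simp_all
  then show ?case
    using rel rels[of u v] by (simp only: eval_word_append[OF f])
qed simp_all

text \<open>Evaluating any representative word is independent of the representative by
  \<open>eval_word_cong\<close>; this is the existence half of the universal property of a presentation.\<close>

lemma presented_monoid_hom_exists:
  assumes f: "f \<in> A \<rightarrow> carrier G"
    and rels: "\<And>u v. \<lbrakk>(u, v) \<in> R; u \<in> lists A; v \<in> lists A\<rbrakk> \<Longrightarrow> eval_word G f u = eval_word G f v"
  obtains h where "h \<in> extensional (carrier (presented_monoid A R))"
    "h \<in> hom (presented_monoid A R) G" "h \<one>\<^bsub>presented_monoid A R\<^esub> = \<one>"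
    "\<And>a. a \<in> A \<Longrightarrow> h (word_cong A R `` {[a]}) = f a"
proof -
  let ?P = "presented_monoid A R" and ?cl = "\<lambda>u. word_cong A R `` {u}"
  define h where
    "h = restrict (\<lambda>X. eval_word G f (SOME u. u \<in> lists A \<and> X = ?cl u)) (carrier ?P)"
  have h: "h (?cl u) = eval_word G f u" if u: "u \<in> lists A" for u
  proof -
    define v where "v = (SOME v. v \<in> lists A \<and> ?cl u = ?cl v)"
    have "v \<in> lists A \<and> ?cl u = ?cl v"
      unfolding v_def by (rule someI_ex) (use u in blast)
    then have "(u, v) \<in> word_cong A R"
      using eq_equiv_class[OF _ equiv_word_cong] by blast
    then have "eval_word G f u = eval_word G f v"
      using eval_word_cong[OF f rels] by blast
    then show ?thesis
      using class_in_presented_monoid[OF u] by (simp add: h_def v_def)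
  qed
  show thesis
  proof
    show "h \<in> extensional (carrier ?P)"
      by (simp add: h_def)
    show "h \<in> hom ?P G"
    proof (rule homI)
      fix X assume "X \<in> carrier ?P"
      then show "h X \<in> carrier G"
        by (elim carrier_presented_monoidE) (simp only: h eval_word_closed[OF f])
    next
      fix X Y assume "X \<in> carrier ?P" "Y \<in> carrier ?P"
      then show "h (X \<otimes>\<^bsub>?P\<^esub> Y) = h X \<otimes> h Y"
        by (elim carrier_presented_monoidE)
          (simp only: presented_monoid_mult h append_in_lists_conv simp_thms eval_word_append[OF f])
    qed
    show "h \<one>\<^bsub>?P\<^esub> = \<one>"
      using h[of "[]"] by (simp add: one_presented_monoid)
    show "h (?cl [a]) = f a" if "a \<in> A" for a
      using h[of "[a]"] that f r_one[of "f a"] by (auto simp del: r_one)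
  qed
qed

end

lemma presented_monoid_hom_eqI:
  assumes h: "h \<in> hom (presented_monoid A R) N" "h' \<in> hom (presented_monoid A R) N"
    and one: "h \<one>\<^bsub>presented_monoid A R\<^esub> = h' \<one>\<^bsub>presented_monoid A R\<^esub>"
    and letters: "\<And>a. a \<in> A \<Longrightarrow> h (word_cong A R `` {[a]}) = h' (word_cong A R `` {[a]})"
    and X: "X \<in> carrier (presented_monoid A R)"
  shows "h X = h' X"
proof -
  let ?cl = "\<lambda>u. word_cong A R `` {u}"
  obtain u where u: "u \<in> lists A" "X = ?cl u"
    using X by (rule carrier_presented_monoidE)
  have "h (?cl u) = h' (?cl u)"
    using u(1)
  proof (induction u)
    case Nil
    then show ?case using one by (simp add: one_presented_monoid)
  next
    case (Cons a u)
    have au: "?cl [a] \<in> carrier (presented_monoid A R)" "?cl u \<in> carrier (presented_monoid A R)"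
      using Cons by (auto intro!: class_in_presented_monoid)
    have "?cl (a # u) = ?cl [a] \<otimes>\<^bsub>presented_monoid A R\<^esub> ?cl u"
      using Cons presented_monoid_mult[of "[a]" A u R] by simp
    then show ?case
      using hom_mult[OF h(1) au] hom_mult[OF h(2) au] letters Cons by simp
  qed
  then show ?thesis using u by simp
qed

section \<open>Laurent polynomials in a group ring\<close>

lemma group_ring_mult_diff:
  "(x - y) \<otimes>\<^bsub>group_ring G\<^esub> z = x \<otimes>\<^bsub>group_ring G\<^esub> z - y \<otimes>\<^bsub>group_ring G\<^esub> z"
  "z \<otimes>\<^bsub>group_ring G\<^esub> (x - y) = z \<otimes>\<^bsub>group_ring G\<^esub> x - z \<otimes>\<^bsub>group_ring G\<^esub> y"
proof -
  show "(x - y) \<otimes>\<^bsub>group_ring G\<^esub> z = x \<otimes>\<^bsub>group_ring G\<^esub> z - y \<otimes>\<^bsub>group_ring G\<^esub> z"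
    by (simp add: group_ring_def frag_extend_diff)
  have "z \<otimes>\<^bsub>group_ring G\<^esub> (x - y) + z \<otimes>\<^bsub>group_ring G\<^esub> y = z \<otimes>\<^bsub>group_ring G\<^esub> x"
    by (simp add: group_ring_def flip: frag_extend_lincomb frag_extend_add)
  then show "z \<otimes>\<^bsub>group_ring G\<^esub> (x - y) = z \<otimes>\<^bsub>group_ring G\<^esub> x - z \<otimes>\<^bsub>group_ring G\<^esub> y"
    by (simp add: eq_diff_eq)
qed

lemma group_ring_mult_zero:
  "0 \<otimes>\<^bsub>group_ring G\<^esub> z = 0" "z \<otimes>\<^bsub>group_ring G\<^esub> 0 = 0"
  using group_ring_mult_diff(1)[of G 0 0 z] group_ring_mult_diff(2)[of G z 0 0] by simp_all

lemma group_ring_mult_frag_of: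
  "frag_of g \<otimes>\<^bsub>group_ring G\<^esub> frag_of h = frag_of (g \<otimes>\<^bsub>G\<^esub> h)"
  by (simp add: group_ring_def)

lemma frag_of_in_group_ring: "g \<in> carrier G \<Longrightarrow> frag_of g \<in> carrier (group_ring G)"
  by (simp add: group_ring_def)

text \<open>Both sides are additive in \<open>p\<close>, so an identity for the powers of \<open>g\<close> and \<open>h\<close> is enough.\<close>

lemma laurent_subst_swap:
  assumes "\<And>k::int. frag_of (g [^]\<^bsub>G\<^esub> k) \<otimes>\<^bsub>group_ring G\<^esub> x =
                    x \<otimes>\<^bsub>group_ring G\<^esub> frag_of (h [^]\<^bsub>G\<^esub> k)"
  shows "laurent_subst G p g \<otimes>\<^bsub>group_ring G\<^esub> x = x \<otimes>\<^bsub>group_ring G\<^esub> laurent_subst G p h"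
proof -
  have "Poly_Mapping.keys p \<subseteq> UNIV" by simp
  then show ?thesis
  proof (induction p rule: frag_induction)
    case zero
    then show ?case by (simp add: laurent_subst_def group_ring_mult_zero)
  next
    case (one k)
    then show ?case using assms by (simp add: laurent_subst_def)
  next
    case (diff p q)
    then show ?case
      by (simp add: laurent_subst_def frag_extend_diff group_ring_mult_diff)
  qed
qed

context group
begin

lemma laurent_subst_closed:
  assumes "g \<in> carrier G"
  shows "laurent_subst G p g \<in> carrier (group_ring G)"
  using assms keys_frag_extend[of "\<lambda>k. frag_of (g [^] k)" p]
  by (auto simp: group_ring_def laurent_subst_def)

lemma int_pow_swap:
  assumes g: "g \<in> carrier G" and h: "h \<in> carrier G" and w: "w \<in> carrier G"
    and eq: "g \<otimes> w = w \<otimes> h"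
  shows "g [^] (k::int) \<otimes> w = w \<otimes> h [^] k"
proof -
  have nat: "g [^] n \<otimes> w = w \<otimes> h [^] n" for n :: nat
  proof (induction n)
    case 0
    then show ?case using w by simp
  next
    case (Suc n)
    have "g [^] Suc n \<otimes> w = g [^] n \<otimes> w \<otimes> h"
      using g h w eq by (simp add: m_assoc)
    then show ?case using Suc g h w by (simp add: m_assoc)
  qed
  show ?thesis
  proof (cases k)
    case (nonneg n)
    then show ?thesis using nat[of n] by (simp add: int_pow_int)
  next
    case (neg n)
    let ?a = "g [^] Suc n" and ?b = "h [^] Suc n"
    have ab: "?a \<in> carrier G" "?b \<in> carrier G"
      using g h by (simp_all del: nat_pow_Suc)
    \<comment> \<open>Cancel \<open>?a\<close> on the left and \<open>?b\<close> on the right of \<open>?a \<otimes> w = w \<otimes> ?b\<close>.\<close>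
    have "inv ?a \<otimes> w = inv ?a \<otimes> (w \<otimes> ?b) \<otimes> inv ?b"
      using ab w by (simp add: m_assoc del: nat_pow_Suc)
    also have "\<dots> = inv ?a \<otimes> (?a \<otimes> w) \<otimes> inv ?b"
      using nat[of "Suc n"] by simp
    also have "\<dots> = w \<otimes> inv ?b"
      using ab w by (simp add: m_assoc[symmetric] del: nat_pow_Suc)
    finally show ?thesis
      using neg g h by (simp only: int_pow_neg int_pow_int)
  qed
qed

text \<open>Conjugation by \<open>w\<close> carries the powers of \<open>h\<close> to the powers of \<open>g\<close>, and therefore the values
  of a Laurent polynomial at \<open>h\<close> to its values at \<open>g\<close>.\<close>

lemma laurent_subst_frag_of_swap:
  assumes "g \<in> carrier G" "h \<in> carrier G" "w \<in> carrier G" "g \<otimes> w = w \<otimes> h"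
  shows "laurent_subst G p g \<otimes>\<^bsub>group_ring G\<^esub> frag_of w =
         frag_of w \<otimes>\<^bsub>group_ring G\<^esub> laurent_subst G p h"
  by (rule laurent_subst_swap) (simp only: group_ring_mult_frag_of int_pow_swap[OF assms])

lemma laurent_subst_commute:
  assumes g: "g \<in> carrier G" and h: "h \<in> carrier G" and gh: "g \<otimes> h = h \<otimes> g"
  shows "laurent_subst G p g \<otimes>\<^bsub>group_ring G\<^esub> laurent_subst G q h =
         laurent_subst G q h \<otimes>\<^bsub>group_ring G\<^esub> laurent_subst G p g"
proof (rule laurent_subst_swap)
  fix k :: int
  have "h \<otimes> g [^] k = g [^] k \<otimes> h"
    using int_pow_swap[OF g g h gh] by simp
  then show "frag_of (g [^] k) \<otimes>\<^bsub>group_ring G\<^esub> laurent_subst G q h =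
             laurent_subst G q h \<otimes>\<^bsub>group_ring G\<^esub> frag_of (g [^] k)"
    using laurent_subst_frag_of_swap[OF h h int_pow_closed[OF g]] by simp
qed

end

section \<open>Braid relations and the odd skeleton\<close>

lemma alternating_Suc_append:
  "alternating a b (Suc n) = alternating a b n @ [if even n then a else b]"
  by (induction n arbitrary: a b) auto

lemma set_alternating: "set (alternating a b n) \<subseteq> {a, b}"
  by (induction n arbitrary: a b) auto

lemma alternating_in_lists: "a \<in> A \<Longrightarrow> b \<in> A \<Longrightarrow> alternating a b n \<in> lists A"
  using set_alternating[of a b n] by auto

text \<open>An off-diagonal odd entry of a Coxeter matrix is at least \<open>3\<close>, hence labels an edge.\<close>

lemma odd_skeletonI:
  assumes "coxeter_matrix S m" "s \<in> S" "t \<in> S" "s \<noteq> t" "m s t = enat n" "odd n"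
  shows "(s, t) \<in> odd_skeleton S m"
proof -
  have "n \<noteq> 1"
    using coxeter_matrix.off_diagonal[OF assms(1-4)] assms(5) by (auto simp: one_enat_def)
  then have "2 < n"
    using \<open>odd n\<close> by presburger
  then show ?thesis
    using assms by (simp add: odd_skeleton_def coxeter_graph_def numeral_eq_enat)
qed

lemma odd_component_eq:
  assumes "coxeter_matrix S m" "s \<in> S" "t \<in> S" "s \<noteq> t" "m s t = enat n" "odd n"
  shows "odd_component S m s = odd_component S m t"
proof -
  have "m t s = enat n"
    using coxeter_matrix.symmetric[OF assms(1-3)] assms(5) by simp
  then have "(s, t) \<in> odd_skeleton S m" "(t, s) \<in> odd_skeleton S m"
    using odd_skeletonI[of S m s t n] odd_skeletonI[of S m t s n] assms by simp_all
  then show ?thesis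
    by (auto simp: odd_component_def intro: converse_rtrancl_into_rtrancl)
qed

abbreviation artin_class :: "'s set \<Rightarrow> ('s \<Rightarrow> 's \<Rightarrow> enat) \<Rightarrow> 's letter list \<Rightarrow> 's letter list set"
  where "artin_class S m w \<equiv> word_cong (artin_letters S) (artin_rels S m) `` {w}"

lemma artin_class_closed:
  "w \<in> lists (artin_letters S) \<Longrightarrow> artin_class S m w \<in> carrier (artin_group S m)"
  by (simp add: artin_group_def class_in_presented_monoid)

lemma artin_class_mult:
  assumes "u \<in> lists (artin_letters S)" "v \<in> lists (artin_letters S)"
  shows "artin_class S m u \<otimes>\<^bsub>artin_group S m\<^esub> artin_class S m v = artin_class S m (u @ v)"
  using presented_monoid_mult[OF assms] by (simp add: artin_group_def)

lemma artin_class_rel: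
  assumes "(u, v) \<in> artin_rels S m" "u \<in> lists (artin_letters S)" "v \<in> lists (artin_letters S)"
  shows "artin_class S m u = artin_class S m v"
  using word_cong.rel[OF assms, of "[]" "[]"] equiv_class_eq[OF equiv_word_cong] by fastforce

text \<open>The braid relation, read as an intertwining relation for the word that both of its sides
  share once the first letter on the left and the last letter on the right are taken off.\<close>

lemma artin_sigma_swap:
  assumes "coxeter_matrix S m" "s \<in> S" "t \<in> S" "s \<noteq> t" "m s t = enat n"
  defines "w \<equiv> artin_class S m (alternating (Sig t) (Sig s) (n - 1))"
  shows "artin_sigma S m s \<otimes>\<^bsub>artin_group S m\<^esub> w =
         w \<otimes>\<^bsub>artin_group S m\<^esub> artin_sigma S m (if odd n then t else s)"
proof -
  \<comment> \<open>The common word has \<open>n - 1\<close> letters; for \<open>n = 0\<close> the truncated subtraction would not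
    leave room for the letter taken off.\<close>
  have "n \<noteq> 0"
    using coxeter_matrix.nonzero[OF assms(1-3)] assms(5) by (auto simp: zero_enat_def)
  then obtain k where n: "n = Suc k"
    using not0_implies_Suc by blast
  have l: "Sig s \<in> artin_letters S" "Sig t \<in> artin_letters S"
    using assms by (auto simp: artin_letters_def)
  have "artin_class S m (alternating (Sig s) (Sig t) n) =
        artin_class S m (alternating (Sig t) (Sig s) n)"
  proof (rule artin_class_rel)
    show "(alternating (Sig s) (Sig t) n, alternating (Sig t) (Sig s) n) \<in> artin_rels S m"
      using assms unfolding artin_rels_def braid_rels_def by blast
  qed (simp_all only: alternating_in_lists l)
  moreover have "alternating (Sig s) (Sig t) n = [Sig s] @ alternating (Sig t) (Sig s) (n - 1)"
    by (simp add: n)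
  moreover have "alternating (Sig t) (Sig s) n =
      alternating (Sig t) (Sig s) (n - 1) @ [Sig (if odd n then t else s)]"
    unfolding n alternating_Suc_append by simp
  ultimately show ?thesis
    using l alternating_in_lists[OF l(2,1)]
    by (simp add: artin_sigma_def w_def artin_class_mult del: append_Cons)
qed

section \<open>The homomorphism of the singular Artin monoid\<close>

primrec desingularization ::
    "'s set \<Rightarrow> ('s \<Rightarrow> 's \<Rightarrow> enat) \<Rightarrow> ('s \<Rightarrow> laurent_poly) \<Rightarrow> 's letter \<Rightarrow> 's letter list set \<Rightarrow>\<^sub>0 int"
  where
    "desingularization S m P (Sig s) = frag_of (artin_class S m [Sig s])"
  | "desingularization S m P (SigInv s) = frag_of (artin_class S m [SigInv s])"
  | "desingularization S m P (Tau s) = laurent_subst (artin_group S m) (P s) (artin_sigma S m s)"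

lemma artin_sigma_closed: "s \<in> S \<Longrightarrow> artin_sigma S m s \<in> carrier (artin_group S m)"
  unfolding artin_sigma_def by (rule artin_class_closed) (simp add: artin_letters_def)

lemma desingularization_closed:
  "desingularization S m P \<in> singular_letters S \<rightarrow> carrier (group_ring (artin_group S m))"
proof
  fix a assume "a \<in> singular_letters S"
  then consider "a \<in> artin_letters S" | s where "s \<in> S" "a = Tau s"
    by (auto simp: singular_letters_def)
  then show "desingularization S m P a \<in> carrier (group_ring (artin_group S m))"
  proof cases
    case 1
    then have "desingularization S m P a = frag_of (artin_class S m [a])"
      by (auto simp: artin_letters_def)
    then show ?thesis
      using 1 artin_class_closed[of "[a]" S m] by (simp add: frag_of_in_group_ring)
  next
    case 2
    then show ?thesis
      using group.laurent_subst_closed[OF group_artin_group artin_sigma_closed] by simp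
  qed
qed

lemma eval_desingularization_artin:
  assumes "w \<in> lists (artin_letters S)"
  shows "eval_word (group_ring (artin_group S m)) (desingularization S m P) w =
         frag_of (artin_class S m w)"
  using assms
proof (induction w)
  case Nil
  then show ?case
    by (simp add: group_ring_def artin_group_def one_presented_monoid)
next
  case (Cons a w)
  have "desingularization S m P a = frag_of (artin_class S m [a])"
    using Cons by (auto simp: artin_letters_def)
  then show ?case
    using Cons artin_class_mult[of "[a]" S w m] by (simp add: group_ring_mult_frag_of)
qed

text \<open>The braid relation of an odd entry conjugates \<open>\<sigma>\<^sub>t\<close> to \<open>\<sigma>\<^sub>s\<close>, so it turns the polynomial of \<open>t\<close>
  evaluated at \<open>\<sigma>\<^sub>t\<close> into the same polynomial evaluated at \<open>\<sigma>\<^sub>s\<close>; this is the image of \<open>\<tau>\<^sub>s\<close> because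
  \<open>P s = P t\<close>.\<close>

lemma desingularization_respects_rels:
  assumes M: "coxeter_matrix S m"
    and P: "\<And>s t n. \<lbrakk>s \<in> S; t \<in> S; s \<noteq> t; m s t = enat n; odd n\<rbrakk> \<Longrightarrow> P s = P t"
    and "(u, v) \<in> singular_artin_rels S m"
  defines "E \<equiv> eval_word (group_ring (artin_group S m)) (desingularization S m P)"
  shows "E u = E v"
proof -
  let ?G = "artin_group S m" and ?Z = "group_ring (artin_group S m)"
  let ?d = "desingularization S m P" and ?\<sigma> = "artin_sigma S m"
  interpret G: group ?G by (rule group_artin_group)
  interpret Z: ring ?Z by (rule ring_group_ring) (rule group_artin_group)
  note closed = Z.eval_word_closed[OF desingularization_closed]
  have frag: "E w = frag_of (artin_class S m w)" if "w \<in> lists (artin_letters S)" for w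
    using eval_desingularization_artin[OF that] by (simp add: E_def)
  have single: "E [a] = ?d a" if "a \<in> singular_letters S" for a
    using funcset_mem[OF desingularization_closed[of S m P] that] by (simp add: E_def)
  have pair: "E [a, b] = ?d a \<otimes>\<^bsub>?Z\<^esub> ?d b"
    if "b \<in> singular_letters S" for a b
    using single[OF that] by (simp add: E_def)
  have letters: "Sig s \<in> artin_letters S" "SigInv s \<in> artin_letters S"
    "Sig s \<in> singular_letters S" "Tau s \<in> singular_letters S" if "s \<in> S" for s
    using that by (auto simp: artin_letters_def singular_letters_def)
  have mixed: "E (Tau s # alternating (Sig t) (Sig s) (n - 1)) =
      E (alternating (Sig t) (Sig s) (n - 1) @ [Tau (if odd n then t else s)])"
    if st: "s \<in> S" "t \<in> S" "s \<noteq> t" "m s t = enat n" for s t n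
  proof -
    let ?a = "alternating (Sig t) (Sig s) (n - 1)" and ?r = "if odd n then t else s"
    have r: "?r \<in> S" "P ?r = P s"
      using st P[of s t n] by auto
    have a: "?a \<in> lists (artin_letters S)" "?a \<in> lists (singular_letters S)"
      using st letters by (simp_all only: alternating_in_lists)
    have "E (Tau s # ?a) = laurent_subst ?G (P s) (?\<sigma> s) \<otimes>\<^bsub>?Z\<^esub> frag_of (artin_class S m ?a)"
      using frag[OF a(1)] by (simp add: E_def)
    also have "\<dots> = frag_of (artin_class S m ?a) \<otimes>\<^bsub>?Z\<^esub> laurent_subst ?G (P s) (?\<sigma> ?r)"
      using st(1) r(1) a(1) artin_sigma_swap[OF M st]
      by (intro G.laurent_subst_frag_of_swap artin_sigma_closed artin_class_closed)
    also have "\<dots> = E ?a \<otimes>\<^bsub>?Z\<^esub> E [Tau ?r]"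
      using frag[OF a(1)] single[OF letters(4)[OF r(1)]] r(2) by simp
    also have "\<dots> = E (?a @ [Tau ?r])"
      using Z.eval_word_append[OF desingularization_closed a(2), of "[Tau ?r]"] letters(4)[OF r(1)]
      by (simp add: E_def)
    finally show ?thesis .
  qed
  consider (artin) "(u, v) \<in> artin_rels S m"
    | (odd) s t n where "s \<in> S" "t \<in> S" "s \<noteq> t" "m s t = enat n" "odd n"
        "u = Tau s # alternating (Sig t) (Sig s) (n - 1)"
        "v = alternating (Sig t) (Sig s) (n - 1) @ [Tau t]"
    | (even) s t n where "s \<in> S" "t \<in> S" "s \<noteq> t" "m s t = enat n" "even n"
        "u = Tau s # alternating (Sig t) (Sig s) (n - 1)"
        "v = alternating (Sig t) (Sig s) (n - 1) @ [Tau s]"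
    | (two) s t where "s \<in> S" "t \<in> S" "m s t = 2" "u = [Tau s, Tau t]" "v = [Tau t, Tau s]"
    | (self) s where "s \<in> S" "u = [Tau s, Sig s]" "v = [Sig s, Tau s]"
    using assms(3) unfolding singular_artin_rels_def singular_rels_def artin_rels_def by blast
  then show ?thesis
  proof cases
    case artin
    then have "u \<in> lists (artin_letters S)" "v \<in> lists (artin_letters S)"
      using letters
      by (auto simp: artin_rels_def inverse_rels_def braid_rels_def
          dest!: subsetD[OF set_alternating])
    then show ?thesis
      using artin_class_rel[OF artin] by (simp only: frag)
  next
    case odd
    then show ?thesis using mixed[OF odd(1-4)] by simp
  next
    case even
    then show ?thesis using mixed[OF even(1-4)] by simp
  next
    case two
    have "s \<noteq> t"
      using two coxeter_matrix.diagonal[OF M] by (auto simp: one_enat_def numeral_eq_enat)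
    then have "?\<sigma> s \<otimes>\<^bsub>?G\<^esub> ?\<sigma> t = ?\<sigma> t \<otimes>\<^bsub>?G\<^esub> ?\<sigma> s"
      using artin_sigma_swap[OF M two(1,2), of 2] two
      by (simp add: artin_sigma_def numeral_eq_enat)
    then show ?thesis
      using two letters G.laurent_subst_commute[OF artin_sigma_closed artin_sigma_closed, of s t]
      by (simp add: pair)
  next
    case self
    have "?\<sigma> s \<in> carrier ?G"
      using self by (simp add: artin_sigma_closed)
    then show ?thesis
      using self letters G.laurent_subst_frag_of_swap[of "?\<sigma> s" "?\<sigma> s" "?\<sigma> s"]
      by (simp add: pair artin_sigma_def)
  qed
qed

text \<open>The class of \<open>SigInv s\<close> is inverse to the class of \<open>Sig s\<close>, so a homomorphism has no freedom
  on it.\<close>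

lemma singular_artin_hom_eqI:
  assumes N: "monoid N"
    and h: "h \<in> hom (singular_artin_monoid S m) N" "h \<one>\<^bsub>singular_artin_monoid S m\<^esub> = \<one>\<^bsub>N\<^esub>"
    and h': "h' \<in> hom (singular_artin_monoid S m) N" "h' \<one>\<^bsub>singular_artin_monoid S m\<^esub> = \<one>\<^bsub>N\<^esub>"
    and sigma: "\<And>s. s \<in> S \<Longrightarrow> h (singular_sigma S m s) = h' (singular_sigma S m s)"
    and tau: "\<And>s. s \<in> S \<Longrightarrow> h (singular_tau S m s) = h' (singular_tau S m s)"
    and X: "X \<in> carrier (singular_artin_monoid S m)"
  shows "h X = h' X"
proof -
  let ?A = "singular_letters S" and ?R = "singular_artin_rels S m"
  let ?P = "singular_artin_monoid S m"
  let ?cl = "\<lambda>w. word_cong ?A ?R `` {w}"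
  have inverse: "h (?cl [SigInv s]) = h' (?cl [SigInv s])" if s: "s \<in> S" for s
  proof -
    have l: "Sig s \<in> ?A" "SigInv s \<in> ?A"
      using s by (auto simp: singular_letters_def artin_letters_def)
    then have c: "?cl [Sig s] \<in> carrier ?P" "?cl [SigInv s] \<in> carrier ?P"
      by (auto simp: singular_artin_monoid_def intro!: class_in_presented_monoid)
    have "([Sig s, SigInv s], []) \<in> ?R" "([SigInv s, Sig s], []) \<in> ?R"
      using s by (auto simp: singular_artin_rels_def inverse_rels_def)
    then have "([Sig s, SigInv s], []) \<in> word_cong ?A ?R" "([SigInv s, Sig s], []) \<in> word_cong ?A ?R"
      using l word_cong.rel[of "[Sig s, SigInv s]" "[]" ?R ?A "[]" "[]"]
        word_cong.rel[of "[SigInv s, Sig s]" "[]" ?R ?A "[]" "[]"] by auto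
    then have "?cl [Sig s, SigInv s] = ?cl []" "?cl [SigInv s, Sig s] = ?cl []"
      using equiv_class_eq[OF equiv_word_cong] by metis+
    then have inv: "?cl [Sig s] \<otimes>\<^bsub>?P\<^esub> ?cl [SigInv s] = \<one>\<^bsub>?P\<^esub>"
      "?cl [SigInv s] \<otimes>\<^bsub>?P\<^esub> ?cl [Sig s] = \<one>\<^bsub>?P\<^esub>"
      using l by (auto simp: singular_artin_monoid_def presented_monoid_mult one_presented_monoid)
    have "h (?cl [SigInv s]) \<otimes>\<^bsub>N\<^esub> h (?cl [Sig s]) = \<one>\<^bsub>N\<^esub>"
      using hom_mult[OF h(1) c(2,1)] inv h(2) by simp
    moreover have "h (?cl [Sig s]) \<otimes>\<^bsub>N\<^esub> h' (?cl [SigInv s]) = \<one>\<^bsub>N\<^esub>"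
      using hom_mult[OF h'(1) c] inv h'(2) sigma[OF s] by (simp add: singular_sigma_def)
    ultimately show ?thesis
      using monoid.inv_unique[OF N] hom_in_carrier[OF h(1)] hom_in_carrier[OF h'(1)] c by blast
  qed
  show ?thesis
  proof (rule presented_monoid_hom_eqI)
    show "h \<in> hom (presented_monoid ?A ?R) N" "h' \<in> hom (presented_monoid ?A ?R) N"
      "h \<one>\<^bsub>presented_monoid ?A ?R\<^esub> = h' \<one>\<^bsub>presented_monoid ?A ?R\<^esub>"
      "X \<in> carrier (presented_monoid ?A ?R)"
      using h h' X by (simp_all add: singular_artin_monoid_def)
    show "h (?cl [a]) = h' (?cl [a])" if "a \<in> ?A" for a
      using that inverse sigma tau
      by (auto simp: singular_letters_def artin_letters_def singular_sigma_def singular_tau_def)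
  qed
qed

theorem proposition2:
  fixes S :: "'s set" and m :: "'s \<Rightarrow> 's \<Rightarrow> enat" and \<Phi> :: "'s set \<Rightarrow> laurent_poly"
  assumes "coxeter_matrix S m"
    and "\<Phi> \<in> odd_components S m \<rightarrow>\<^sub>E UNIV"
  shows "\<exists>!\<Delta>. \<Delta> \<in> extensional (carrier (singular_artin_monoid S m)) \<and>
    \<Delta> \<in> hom (singular_artin_monoid S m) (group_ring (artin_group S m)) \<and>
    \<Delta> \<one>\<^bsub>singular_artin_monoid S m\<^esub> = \<one>\<^bsub>group_ring (artin_group S m)\<^esub> \<and>
    (\<forall>s\<in>S. \<Delta> (singular_sigma S m s) = frag_of (artin_sigma S m s)) \<and>
    (\<forall>s\<in>S. \<Delta> (singular_tau S m s) =
      laurent_subst (artin_group S m) (\<Phi> (odd_component S m s)) (artin_sigma S m s))"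
proof -
  let ?Z = "group_ring (artin_group S m)" and ?M = "singular_artin_monoid S m"
  let ?d = "desingularization S m (\<lambda>s. \<Phi> (odd_component S m s))"
  interpret Z: ring ?Z by (rule ring_group_ring) (rule group_artin_group)
  have rels: "eval_word ?Z ?d u = eval_word ?Z ?d v" if "(u, v) \<in> singular_artin_rels S m" for u v
    using odd_component_eq[OF assms(1)]
    by (intro desingularization_respects_rels[OF assms(1) _ that]) metis
  obtain h where h: "h \<in> extensional (carrier ?M)" "h \<in> hom ?M ?Z" "h \<one>\<^bsub>?M\<^esub> = \<one>\<^bsub>?Z\<^esub>"
    and letters: "\<And>a. a \<in> singular_letters S \<Longrightarrow>
      h (word_cong (singular_letters S) (singular_artin_rels S m) `` {[a]}) = ?d a"
    unfolding singular_artin_monoid_def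
    using Z.presented_monoid_hom_exists[OF desingularization_closed rels] by blast
  have sigma: "h (singular_sigma S m s) = frag_of (artin_sigma S m s)" if "s \<in> S" for s
    using letters[of "Sig s"] that
    by (simp add: singular_letters_def artin_letters_def singular_sigma_def artin_sigma_def)
  have tau: "h (singular_tau S m s) =
      laurent_subst (artin_group S m) (\<Phi> (odd_component S m s)) (artin_sigma S m s)" if "s \<in> S" for s
    using letters[of "Tau s"] that by (simp add: singular_letters_def singular_tau_def)
  show ?thesis
  proof (rule ex1I[of _ h], goal_cases)
    case 1
    then show ?case using h sigma tau by blast
  next
    case (2 h')
    show ?case
    proof (rule extensionalityI)
      fix X assume "X \<in> carrier ?M"
      then show "h' X = h X"
        using 2 h sigma tau by - (rule singular_artin_hom_eqI[OF Z.monoid_axioms], simp_all)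
    qed (use 2 h in blast)+
  qed
qed

end
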